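(* Let $\{A, B\}$ be an internal couple with respect to the Poincaré sphere $\mathcal{B}_d = \{(x,y,z) \in \mathbb{R}^3 : (x - \frac12)^2 + y^2 + z^2 = (\frac12)^2\}$, and denote the matrices in $\mathbb{M}_2$ corresponding to the points $A$ and $B$ again by $A$ and $B$. Then $A \triangle_{\lambda} B$ for some real $\lambda$ with $0 \le \lambda < 1$.
   Context: $\mathbb{M}_2$ is the algebra of $2 \times 2$ complex matrices, with identity $I_2$. Points of the closed ball bounded by $\mathcal{B}_d$ are identified with $2\times 2$ matrices by the real affine correspondence $(x, y, z) \leftrightarrow \begin{bmatrix} x & y + iz \\ y - iz & 1 - x \end{bmatrix}$ (points of $\mathcal{B}_d$ itself correspond to the rank one projections). Let $\mathcal{P}$ be a sphere in $\mathbb{R}^3$ and let $A, B$ be two distinct points in its interior. $\{A, B\}$ is called an internal couple with respect to $\mathcal{P}$ if the sphere having the line segment $AB$ as a diameter lies inside $\mathcal{P}$, i.e. is contained in the closed ball bounded by $\mathcal{P}$. For $2\times2$ matrices $A, B$ with $0 \le A, B \le I_2$ and real $\lambda$ with $0 \le \lambda < 1$, $A \triangle_\lambda B$ ($\lambda$-compatibility) means $|A - B| + |I_2 - A - B| = (1 - \lambda) I_2$, where $|X| := (X^*X)^{1/2}$. *)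

theory Defs
  imports "HOL-Analysis.Analysis"
begin

definition conj_transpose :: "complex^'n^'m \<Rightarrow> complex^'m^'n" where
  "conj_transpose A = (\<chi> i j. cnj (A $ j $ i))"

definition pos_semidef :: "complex^'n^'n \<Rightarrow> bool" where
  "pos_semidef A \<longleftrightarrow> conj_transpose A = A \<and>
     (\<forall>v. 0 \<le> Re (\<Sum>i\<in>UNIV. cnj (v $ i) * (A *v v) $ i))"

definition loewner_le :: "complex^'n^'n \<Rightarrow> complex^'n^'n \<Rightarrow> bool" where
  "loewner_le A B \<longleftrightarrow> pos_semidef (B - A)"

text \<open>A positive semidefinite matrix has exactly one positive semidefinite square root;
  on other arguments the value of \<open>matrix_sqrt\<close> is unspecified.\<close>
definition matrix_sqrt :: "complex^'n^'n \<Rightarrow> complex^'n^'n" where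
  "matrix_sqrt A = (THE P. pos_semidef P \<and> P ** P = A)"

definition matrix_abs :: "complex^'n^'n \<Rightarrow> complex^'n^'n" where
  "matrix_abs X = matrix_sqrt (conj_transpose X ** X)"

text \<open>The relation is only meaningful for matrices between \<open>0\<close> and the identity; this proviso
  is part of the definition, so that asserting the relation asserts the proviso as well.\<close>
definition lambda_compatible :: "real \<Rightarrow> complex^2^2 \<Rightarrow> complex^2^2 \<Rightarrow> bool" where
  "lambda_compatible l A B \<longleftrightarrow>
     loewner_le 0 A \<and> loewner_le A (mat 1) \<and> loewner_le 0 B \<and> loewner_le B (mat 1) \<and>
     matrix_abs (A - B) + matrix_abs (mat 1 - A - B) = (1 - l) *\<^sub>R mat 1"

definition poincare_sphere :: "(real^3) set" where
  "poincare_sphere = {p. (p $ 1 - 1/2)^2 + (p $ 2)^2 + (p $ 3)^2 = (1/2)^2}"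

definition matrix_of_point :: "real^3 \<Rightarrow> complex^2^2" where
  "matrix_of_point p =
     vector [vector [complex_of_real (p $ 1), complex_of_real (p $ 2) + \<i> * complex_of_real (p $ 3)],
             vector [complex_of_real (p $ 2) - \<i> * complex_of_real (p $ 3), 1 - complex_of_real (p $ 1)]]"

text \<open>\<open>P\<close> is the sphere as a point set. Its centre \<open>c\<close> and radius \<open>r\<close> are
  determined by \<open>P\<close>, so the existential quantifier only names them.\<close>
definition internal_couple :: "real^3 \<Rightarrow> real^3 \<Rightarrow> (real^3) set \<Rightarrow> bool" where
  "internal_couple A B P \<longleftrightarrow>
     (\<exists>c r. 0 < r \<and> P = sphere c r \<and> A \<noteq> B \<and> A \<in> ball c r \<and> B \<in> ball c r \<and>
        sphere (midpoint A B) (dist A B / 2) \<subseteq> cball c r)"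

end

theory Submission
  imports Defs
begin

text \<open>For Hermitian traceless \<open>2 \<times> 2\<close> matrices \<open>X\<close> the square of \<open>X\<close> is scalar, so \<open>|X|\<close> is a
  scalar matrix. Both \<open>A - B\<close> and \<open>I - A - B\<close> are of this kind: with \<open>c\<close> the centre of the
  Poincare sphere and \<open>m\<close> the midpoint of \<open>AB\<close>, their absolute values are the multiples \<open>|AB|\<close>
  and \<open>2 |mc|\<close> of the identity. The sphere with diameter \<open>AB\<close> lies in the ball exactly when
  \<open>|mc| + |AB| / 2 \<le> 1 / 2\<close>, that is, when the sum of the two multiples is at most \<open>1\<close>.\<close>

definition cinner :: "complex^'n \<Rightarrow> complex^'n \<Rightarrow> complex" where
  "cinner v w = (\<Sum>i\<in>UNIV. cnj (v $ i) * w $ i)"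

lemma cinner_add_right: "cinner v (w + w') = cinner v w + cinner v w'"
  by (simp add: cinner_def sum.distrib ring_distribs)

lemma cinner_scaleR_right: "cinner v (a *\<^sub>R w) = a *\<^sub>R cinner v w"
  by (simp add: cinner_def scaleR_sum_right)

lemma cinner_self: "cinner v v = of_real (\<Sum>i\<in>UNIV. (cmod (v $ i))\<^sup>2)"
  by (simp add: cinner_def complex_norm_square mult.commute del: of_real_power)

lemma Re_cinner_self_nonneg: "0 \<le> Re (cinner v v)"
  by (simp add: cinner_self sum_nonneg)

lemma Re_cinner_self_eq_0_iff: "Re (cinner v v) = 0 \<longleftrightarrow> v = 0"
  by (simp add: cinner_self sum_nonneg_eq_0_iff vec_eq_iff)

lemma cinner_conj_transpose: "cinner (conj_transpose A *v v) w = cinner v (A *v w)"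
  unfolding cinner_def matrix_vector_mult_def conj_transpose_def
  by (simp add: sum_distrib_left sum_distrib_right mult_ac) (rule sum.swap)

lemma conj_transpose_diff: "conj_transpose (A - B) = conj_transpose A - conj_transpose B"
  by (simp add: conj_transpose_def vec_eq_iff)

lemma conj_transpose_mat_1: "conj_transpose (mat 1) = mat 1"
  by (simp add: conj_transpose_def mat_def vec_eq_iff)

lemma conj_transpose_scaleR: "conj_transpose (a *\<^sub>R A) = a *\<^sub>R conj_transpose A"
  by (simp add: conj_transpose_def vec_eq_iff)

lemma pos_semidef_iff:
  "pos_semidef A \<longleftrightarrow> conj_transpose A = A \<and> (\<forall>v. 0 \<le> Re (cinner v (A *v v)))"
  by (simp add: pos_semidef_def cinner_def)

lemma scaleR_matrix_vector: "(a *\<^sub>R A) *v v = a *\<^sub>R (A *v (v :: complex^'n))"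
  by (simp add: matrix_vector_mult_def vec_eq_iff scaleR_sum_right)

lemma pos_semidef_scaleR_mat_1: "0 \<le> a \<Longrightarrow> pos_semidef (a *\<^sub>R mat 1)"
  by (simp add: pos_semidef_iff conj_transpose_scaleR conj_transpose_mat_1
      scaleR_matrix_vector cinner_scaleR_right Re_cinner_self_nonneg)

text \<open>Since \<open>A\<close> is Hermitian, pairing the equation with \<open>v\<close> turns
  the quadratic form of \<open>A\<close> at \<open>v\<close> into the squared norm of
  \<open>A *v v\<close> plus \<open>a\<close> times that of \<open>v\<close>.\<close>

lemma pos_semidef_of_square_add_scalar:
  assumes "conj_transpose A = A" and "A = A ** A + a *\<^sub>R mat 1" and "0 \<le> a"
  shows "pos_semidef A"
  unfolding pos_semidef_iff
proof (intro conjI allI)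
  fix v
  have "A *v v = A *v (A *v v) + a *\<^sub>R v"
    by (subst assms(2)) (simp add: matrix_vector_mult_add_rdistrib matrix_vector_mul_assoc
        scaleR_matrix_vector)
  then have "cinner v (A *v v) = cinner (A *v v) (A *v v) + a *\<^sub>R cinner v v"
    using cinner_conj_transpose[of A v "A *v v"] assms(1)
    by (metis cinner_add_right cinner_scaleR_right)
  then show "0 \<le> Re (cinner v (A *v v))"
    using assms(3) by (simp add: Re_cinner_self_nonneg)
qed (fact assms(1))

text \<open>Uniqueness of the root that \<open>matrix_sqrt\<close> selects, for scalar matrices
  only. As (P + a)(P - a) = 0, the range of P - a lies in the eigenspace of \<open>P\<close> for -a,
  which positivity makes trivial when a > 0.\<close>

lemma pos_semidef_sqrt_scalar:
  assumes P: "pos_semidef P" and PP: "P ** P = a\<^sup>2 *\<^sub>R mat 1" and "0 \<le> a"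
  shows "P = a *\<^sub>R mat 1"
proof -
  have "P *v v = a *\<^sub>R v" for v
  proof -
    have PPv: "P *v (P *v v) = a\<^sup>2 *\<^sub>R v"
      by (simp add: matrix_vector_mul_assoc PP scaleR_matrix_vector)
    define w where "w = P *v v - a *\<^sub>R v"
    have "w = 0"
    proof (cases "a = 0")
      case True
      \<comment> \<open>The eigenvalue -a is not negative here, so \<open>P ** P = 0\<close> is
        combined with \<open>P\<close> being Hermitian instead.\<close>
      have "cinner (P *v v) (P *v v) = cinner v (P *v (P *v v))"
        using P cinner_conj_transpose[of P] by (simp add: pos_semidef_iff)
      also have "\<dots> = 0"
        by (simp add: PPv True cinner_def)
      finally show ?thesis
        using Re_cinner_self_eq_0_iff[of "P *v v"] by (simp add: w_def True)
    next
      case False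
      text \<open>\<open>w\<close> is an eigenvector of \<open>P\<close> for the negative eigenvalue \<open>- a\<close>.\<close>
      have "P *v (a *\<^sub>R v) = a *\<^sub>R (P *v v)"
        by (simp add: matrix_vector_mult_def vec_eq_iff scaleR_sum_right)
      then have "P *v w = - a *\<^sub>R w"
        by (simp add: w_def matrix_vector_mult_diff_distrib PPv algebra_simps power2_eq_square)
      then have "0 \<le> - a * Re (cinner w w)"
        using P by (metis pos_semidef_iff cinner_scaleR_right scaleR_complex.sel(1))
      then have "Re (cinner w w) = 0"
        using False \<open>0 \<le> a\<close> Re_cinner_self_nonneg[of w]
        by (simp add: mult_le_0_iff)
      then show ?thesis
        by (simp add: Re_cinner_self_eq_0_iff)
    qed
    then show ?thesis
      by (simp add: w_def)
  qed
  then show ?thesis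
    by (simp add: matrix_eq scaleR_matrix_vector)
qed

lemma matrix_abs_of_scalar_square:
  assumes "conj_transpose X = X" and "X ** X = a\<^sup>2 *\<^sub>R mat 1" and "0 \<le> a"
  shows "matrix_abs X = a *\<^sub>R mat 1"
proof -
  have "(a *\<^sub>R mat 1) ** (a *\<^sub>R mat 1) = a\<^sup>2 *\<^sub>R (mat 1 :: complex^'n^'n)"
    by (simp add: matrix_eq scaleR_matrix_vector power2_eq_square
        flip: matrix_vector_mul_assoc)
  then show ?thesis
    unfolding matrix_abs_def matrix_sqrt_def assms(1,2)
    using pos_semidef_scaleR_mat_1[OF assms(3)] pos_semidef_sqrt_scalar[OF _ _ assms(3)]
    by (intro the_equality) auto
qed

text \<open>The bound comes from the point of the sphere farthest from \<open>c\<close>, which lies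
  beyond \<open>a\<close> on the ray from \<open>c\<close> through \<open>a\<close>; if
  \<open>a = c\<close>, any direction \<open>e\<close> serves.\<close>

lemma dist_le_of_sphere_subset_cball:
  fixes a c :: "'a::euclidean_space"
  assumes "sphere a r \<subseteq> cball c s" and "0 \<le> r"
  shows "dist a c + r \<le> s"
proof -
  obtain e where e: "norm e = 1" "a - c = norm (a - c) *\<^sub>R e"
  proof (cases "a = c")
    case True
    obtain e :: 'a where "norm e = 1"
      using vector_choose_size[of 1] by auto
    with True that show ?thesis
      by simp
  next
    case False
    with that[of "sgn (a - c)"] show ?thesis
      by (simp add: norm_sgn sgn_div_norm)
  qed
  have "a + r *\<^sub>R e \<in> sphere a r"
    using e(1) assms(2) by (simp add: dist_norm)
  then have "norm (a + r *\<^sub>R e - c) \<le> s"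
    using assms(1) by (metis dist_norm dist_commute mem_cball subsetD)
  moreover have "a + r *\<^sub>R e - c = (norm (a - c) + r) *\<^sub>R e"
    unfolding scaleR_left_distrib e(2)[symmetric] by simp
  ultimately show ?thesis
    using e(1) assms(2) by (simp add: dist_norm)
qed

definition poincare_centre :: "real^3" where
  "poincare_centre = vector [1/2, 0, 0]"

lemma dist_poincare_centre:
  "(dist poincare_centre p)\<^sup>2 = (p $ 1 - 1/2)\<^sup>2 + (p $ 2)\<^sup>2 + (p $ 3)\<^sup>2"
  by (simp add: dist_vec_def L2_set_def sum_3 poincare_centre_def dist_real_def power2_commute)

lemma poincare_sphere_eq: "poincare_sphere = sphere poincare_centre (1/2)"
proof -
  have "(dist poincare_centre p)\<^sup>2 = (1/2)\<^sup>2 \<longleftrightarrow> dist poincare_centre p = 1/2" for p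
    by (rule power2_eq_iff_nonneg) simp_all
  then show ?thesis
    unfolding poincare_sphere_def sphere_def dist_poincare_centre by (simp only:)
qed

lemma conj_transpose_matrix_of_point:
  "conj_transpose (matrix_of_point p) = matrix_of_point p"
  by (simp add: conj_transpose_def matrix_of_point_def vec_eq_iff forall_2)

text \<open>This is Cayley-Hamilton: the matrix has trace 1, and the scalar is its determinant,
  nonnegative exactly on the closed ball.\<close>

lemma matrix_of_point_square:
  "matrix_of_point p = matrix_of_point p ** matrix_of_point p
     + ((1/2)\<^sup>2 - (dist poincare_centre p)\<^sup>2) *\<^sub>R mat 1"
  unfolding dist_poincare_centre
  by (simp add: matrix_of_point_def matrix_matrix_mult_def vec_eq_iff forall_2 sum_2 mat_def
      complex_eq_iff power2_eq_square algebra_simps)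

lemma matrix_of_point_bounds:
  assumes "dist poincare_centre p \<le> 1/2"
  shows "loewner_le 0 (matrix_of_point p)" "loewner_le (matrix_of_point p) (mat 1)"
proof -
  let ?A = "matrix_of_point p" and ?d = "(1/2)\<^sup>2 - (dist poincare_centre p)\<^sup>2"
  have d: "0 \<le> ?d"
    using power_mono[OF assms, of 2] by simp
  show "loewner_le 0 ?A"
    using pos_semidef_of_square_add_scalar[OF conj_transpose_matrix_of_point
        matrix_of_point_square d]
    by (simp add: loewner_le_def)
  \<comment> \<open>The complement \<open>mat 1 - ?A\<close> has the same trace and determinant as
    \<open>?A\<close>, hence satisfies the same quadratic equation.\<close>
  have "(mat 1 - ?A) ** (mat 1 - ?A) + ?d *\<^sub>R mat 1
      = mat 1 - ?A - ?A + (?A ** ?A + ?d *\<^sub>R mat 1)"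
    by (simp only: matrix_eq matrix_vector_mult_add_rdistrib matrix_vector_mult_diff_rdistrib
        matrix_vector_mult_diff_distrib matrix_vector_mul_lid flip: matrix_vector_mul_assoc)
      (simp add: algebra_simps)
  also have "\<dots> = mat 1 - ?A"
    by (simp flip: matrix_of_point_square)
  finally show "loewner_le ?A (mat 1)"
    unfolding loewner_le_def
    by (intro pos_semidef_of_square_add_scalar[OF _ _ d])
      (simp_all add: conj_transpose_diff conj_transpose_mat_1 conj_transpose_matrix_of_point)
qed

text \<open>The difference has trace 0 and determinant minus the squared distance, so its square is
  scalar.\<close>

lemma matrix_abs_diff:
  "matrix_abs (matrix_of_point p - matrix_of_point q) = dist p q *\<^sub>R mat 1"
proof (rule matrix_abs_of_scalar_square)
  have "(dist p q)\<^sup>2 = (p $ 1 - q $ 1)\<^sup>2 + (p $ 2 - q $ 2)\<^sup>2 + (p $ 3 - q $ 3)\<^sup>2"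
    by (simp add: dist_vec_def L2_set_def sum_3 dist_real_def)
  then show "(matrix_of_point p - matrix_of_point q) ** (matrix_of_point p - matrix_of_point q)
      = (dist p q)\<^sup>2 *\<^sub>R mat 1"
    by (simp add: matrix_of_point_def matrix_matrix_mult_def vec_eq_iff forall_2 sum_2 mat_def
      complex_eq_iff power2_eq_square algebra_simps)
qed (simp_all add: conj_transpose_diff conj_transpose_matrix_of_point)

text \<open>The complement corresponds to the reflection of \<open>p\<close> in the centre. Thus I -
  A - B is again a difference of two point matrices, and \<open>matrix_abs_diff\<close> applies to
  it.\<close>

lemma mat_1_diff_matrix_of_point:
  "mat 1 - matrix_of_point p = matrix_of_point (2 *\<^sub>R poincare_centre - p)"
  by (simp add: matrix_of_point_def vec_eq_iff forall_2 mat_def poincare_centre_def)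

theorem theorem3p9:
  fixes A B :: "real^3"
  assumes "internal_couple A B poincare_sphere"
  shows "\<exists>l::real. 0 \<le> l \<and> l < 1 \<and>
           lambda_compatible l (matrix_of_point A) (matrix_of_point B)"
proof -
  let ?c = poincare_centre and ?m = "midpoint A B"
  obtain c r where r: "0 < r" and P: "sphere ?c (1/2) = sphere c r" and "A \<noteq> B"
    and AB: "A \<in> ball c r" "B \<in> ball c r" and sub: "sphere ?m (dist A B / 2) \<subseteq> cball c r"
    using assms by (auto simp: internal_couple_def poincare_sphere_eq)
  \<comment> \<open>The hypothesis only supplies some \<open>c\<close> and \<open>r\<close> with the
    same sphere. Placing each sphere in the ball of the other forces the centres and radii to
    agree.\<close>
  have "dist ?c c + 1/2 \<le> r"
    by (rule dist_le_of_sphere_subset_cball) (simp_all add: P)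
  moreover have "dist c ?c + r \<le> 1/2"
    using r by (intro dist_le_of_sphere_subset_cball) (simp_all flip: P)
  ultimately have "dist ?c c = 0" and r': "r = 1/2"
    using zero_le_dist[of ?c c] unfolding dist_commute[of c ?c] by linarith+
  then have c: "c = ?c"
    by simp
  have le: "dist ?m ?c + dist A B / 2 \<le> 1/2"
    using dist_le_of_sphere_subset_cball[OF sub] by (simp add: c r')
  have "dist (2 *\<^sub>R ?c - A) B = norm (2 *\<^sub>R (?c - ?m))"
    by (simp add: dist_norm midpoint_def algebra_simps)
  also have "\<dots> = 2 * dist ?m ?c"
    by (simp add: dist_norm norm_minus_commute)
  finally have "matrix_abs (mat 1 - matrix_of_point A - matrix_of_point B)
      = (2 * dist ?m ?c) *\<^sub>R mat 1"
    by (simp add: mat_1_diff_matrix_of_point matrix_abs_diff)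
  \<comment> \<open>The two absolute values dictate this parameter: \<open>le\<close> makes it
    nonnegative, and \<open>A \<noteq> B\<close> keeps it below 1.\<close>
  then have "lambda_compatible (1 - (dist A B + 2 * dist ?m ?c))
      (matrix_of_point A) (matrix_of_point B)"
    using AB by (simp add: lambda_compatible_def matrix_of_point_bounds c r' matrix_abs_diff
        scaleR_left_distrib)
  moreover have "0 < dist A B + 2 * dist ?m ?c"
    using \<open>A \<noteq> B\<close> by (simp add: add_pos_nonneg)
  ultimately show ?thesis
    using le by (intro exI[of _ "1 - (dist A B + 2 * dist ?m ?c)"]) simp
qed

end
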